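(* Let $B$ and $B'$ be the two oriented, component-indexed versions of the Borromean rings, given by the diagrams described in the context. Then there is no isomorphism of $\Lambda$-modules $f:M_A^{\mathrm{red}}(B)\to M_A^{\mathrm{red}}(B')$ such that $f(M_1(B))=M_1(B')$, $f(M_2(B))=M_2(B')$, $f(M_3(B))=M_3(B')$ and $f(\chi_1(B))=\chi_1(B')$. In particular, $M_A^{\mathrm{enr}}(B)\not\cong M_A^{\mathrm{enr}}(B')$.
   Context: **Crossing data of a diagram.** For an oriented (virtual) link diagram $D$ with components $K_1,\dots,K_\mu$, the underpassing strand is cut at each classical crossing; $A(D)$ is the set of resulting arcs, $C(D)$ the set of classical crossings, and $\kappa_D:A(D)\to\{1,\dots,\mu\}$ sends an arc to the index of its component. For $c\in C(D)$: $a(c)$ is the overpassing arc, $b_1(c)$ the underpassing arc on the right-hand side of the oriented arc $a(c)$, and $b_2(c)$ the underpassing arc on its left-hand side. The writhe $w(c)$ is $+1$ if the underpassing strand is oriented from $b_1(c)$ to $b_2(c)$, and $-1$ if it is oriented from $b_2(c)$ to $b_1(c)$. **Reduced Alexander module.** $\Lambda=\mathbb Z[t,t^{-1}]$. $\varrho_D:\Lambda^{C(D)}\to\Lambda^{A(D)}$ is the $\Lambda$-linear map between free modules with $\varrho_D(c)=(1-t)a(c)+tb_1(c)-b_2(c)$. $M_A^{\mathrm{red}}(D)=\operatorname{coker}\varrho_D$, with quotient map $\varsigma_D:\Lambda^{A(D)}\to M_A^{\mathrm{red}}(D)$. **The map $\varphi_D$.** $\epsilon:\Lambda\to\mathbb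 Z$ is the ring homomorphism with $\epsilon(t^{\pm1})=1$, and $\mathbb Z_\epsilon$ is $\mathbb Z$ with the $\Lambda$-action $\lambda\cdot n=\epsilon(\lambda)n$. $\varphi_D:M_A^{\mathrm{red}}(D)\to\Lambda\oplus(\mathbb Z_\epsilon)^{\mu-1}$ is the $\Lambda$-linear map with $\varphi_D(\varsigma_D(a))=(1,0,\dots,0)$ if $\kappa_D(a)=1$, and $\varphi_D(\varsigma_D(a))=(1,0,\dots,0,1,0,\dots,0)$, with the second $1$ in the $i$th coordinate, if $\kappa_D(a)=i>1$. **Peripheral elements.** $M_i(D)$, the set of meridians of $K_i$, is the set of all $x\in M_A^{\mathrm{red}}(D)$ with $\varphi_D(x)=\varphi_D(\varsigma_D(a))$ for any arc $a$ with $\kappa_D(a)=i$. The longitude of $K_i$ is $$\chi_i(D)=\varsigma_D\Big(\sum_{c\in C(D),\,\kappa_D(b_1(c))=i}w(c)a(c)-\tfrac12\sum_{c\in C(D),\,\kappa_D(b_1(c))=i}w(c)(b_1(c)+b_2(c))\Big),$$ where the second sum has all coefficients in $\{-2,0,2\}$. **Enhanced module.** $M_A^{\mathrm{enr}}(D)=(M_A^{\mathrm{red}}(D),M_1(D),\dots,M_\mu(D),\chi_1(D),\dots,\chi_\mu(D))$. For $\mu$-component diagrams $D,D'$, an isomorphism $M_A^{\mathrm{enr}}(D)\to M_A^{\mathrm{enr}}(D')$ is a $\Lambda$-module isomorphism $f:M_A^{\mathrm{red}}(D)\to M_A^{\mathrm{red}}(D')$ with $f(M_i(D))=M_i(D')$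 and $f(\chi_i(D))=\chi_i(D')$ for all $i$. **The diagrams $B$ and $B'$.** $B$ is the standard classical six-crossing diagram of the Borromean rings (three round circles, $K_1$ on the left, $K_2$ on the right, $K_3$ at the bottom, all oriented counterclockwise). Its arcs are $u,v$ (in $K_1$), $w,x$ (in $K_2$), $y,z$ (in $K_3$), and its six crossings have the following data $(a(c),b_1(c),b_2(c))$ and writhes: $(y,u,v)$, $(u,w,x)$, $(w,y,z)$, each with writhe $+1$; and $(z,u,v)$, $(v,w,x)$, $(x,y,z)$, each with writhe $-1$. $B'$ is obtained from the same diagram by reversing the orientations of all three components. With its arcs suitably named $u',v'$ (in $K'_1$), $w',x'$ (in $K'_2$), $y',z'$ (in $K'_3$), its crossings have data $(y',u',v')$, $(u',w',x')$, $(w',y',z')$, each with writhe $-1$; and $(z',u',v')$, $(v',w',x')$, $(x',y',z')$, each with writhe $+1$. *)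

theory Defs
  imports
    "HOL-Library.Poly_Mapping"
    "HOL-Algebra.Module"
    "HOL-Algebra.AbelCoset"
    "HOL-Algebra.Algebraic_Closure_Type"
begin

section \<open>Laurent polynomials\<close>

text \<open>
  Finitely supported functions from \<open>\<int>\<close> to \<open>\<int>\<close> with the convolution product are the group ring
  of the infinite cyclic group, i.e. \<open>\<Lambda> = \<int>[t, t\<^sup>-\<^sup>1]\<close>; \<open>single k n\<close> is the monomial \<open>n t\<^sup>k\<close>.
\<close>

type_synonym laurent = "int \<Rightarrow>\<^sub>0 int"

abbreviation Lambda :: "laurent ring"  (\<open>\<Lambda>\<close>)
  where "\<Lambda> \<equiv> ring_of_type_algebra"

definition tvar :: laurent
  where "tvar = Poly_Mapping.single 1 1"

definition augmentation :: "laurent \<Rightarrow> int"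
  where "augmentation p = (\<Sum>k\<in>Poly_Mapping.keys p. Poly_Mapping.lookup p k)"

section \<open>Modules\<close>

definition linear_maps ::
    "('r, 'k) ring_scheme \<Rightarrow> ('r, 'm, 'x) module_scheme \<Rightarrow> ('r, 'n, 'y) module_scheme \<Rightarrow> ('m \<Rightarrow> 'n) set"
  where "linear_maps R M N = {f \<in> carrier M \<rightarrow> carrier N.
    (\<forall>x\<in>carrier M. \<forall>y\<in>carrier M. f (x \<oplus>\<^bsub>M\<^esub> y) = f x \<oplus>\<^bsub>N\<^esub> f y) \<and>
    (\<forall>r\<in>carrier R. \<forall>x\<in>carrier M. f (r \<odot>\<^bsub>M\<^esub> x) = r \<odot>\<^bsub>N\<^esub> f x)}"

definition module_isos ::
    "('r, 'k) ring_scheme \<Rightarrow> ('r, 'm, 'x) module_scheme \<Rightarrow> ('r, 'n, 'y) module_scheme \<Rightarrow> ('m \<Rightarrow> 'n) set"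
  where "module_isos R M N = {f \<in> linear_maps R M N. bij_betw f (carrier M) (carrier N)}"

text \<open>
  Module records extend ring records; the ring multiplication and unit play no role for modules and
  are left unspecified below.
\<close>

definition quotient_module :: "('r, 'm, 'x) module_scheme \<Rightarrow> 'm set \<Rightarrow> ('r, 'm set) module"
  where "quotient_module M N =
    \<lparr>carrier = a_rcosets\<^bsub>M\<^esub> N, monoid.mult = undefined, one = undefined,
     ring.zero = N, add = set_add M,
     module.smult = (\<lambda>r K. \<Union>x\<in>K. N +>\<^bsub>M\<^esub> (r \<odot>\<^bsub>M\<^esub> x))\<rparr>"

text \<open>The free module on a finite set \<open>S\<close>: functions vanishing outside \<open>S\<close>.\<close>

definition free_module :: "'a set \<Rightarrow> (laurent, 'a \<Rightarrow> laurent) module"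
  where "free_module S =
    \<lparr>carrier = {f. \<forall>s. s \<notin> S \<longrightarrow> f s = 0}, monoid.mult = undefined, one = undefined,
     ring.zero = (\<lambda>s. 0), add = (\<lambda>f g s. f s + g s),
     module.smult = (\<lambda>r f s. r * f s)\<rparr>"

definition gen :: "'a \<Rightarrow> 'a \<Rightarrow> laurent"
  where "gen a = (\<lambda>s. if s = a then 1 else 0)"

section \<open>Crossing data of a link diagram\<close>

record ('a, 'c) link_diagram =
  num_comps :: nat
  arcs :: "'a set"
  crossings :: "'c set"
  comp_of :: "'a \<Rightarrow> nat"
  over_arc :: "'c \<Rightarrow> 'a"
  under_right :: "'c \<Rightarrow> 'a"
  under_left :: "'c \<Rightarrow> 'a"
  writhe :: "'c \<Rightarrow> int"

definition wf_diagram :: "('a, 'c) link_diagram \<Rightarrow> bool"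
  where "wf_diagram D \<longleftrightarrow> finite (arcs D) \<and> finite (crossings D) \<and>
    comp_of D ` arcs D = {1..num_comps D} \<and>
    (\<forall>c\<in>crossings D. over_arc D c \<in> arcs D \<and> under_right D c \<in> arcs D \<and> under_left D c \<in> arcs D \<and>
      comp_of D (under_right D c) = comp_of D (under_left D c) \<and> writhe D c \<in> {1, -1})"

section \<open>The reduced Alexander module\<close>

text \<open>
  The linear map sending the generator of a crossing \<open>c\<close>
  to \<open>(1 - t) a(c) + t b\<^sub>1(c) - b\<^sub>2(c)\<close>.
\<close>

definition rho :: "('a, 'c) link_diagram \<Rightarrow> ('c \<Rightarrow> laurent) \<Rightarrow> 'a \<Rightarrow> laurent"
  where "rho D g = (\<lambda>s. \<Sum>c\<in>crossings D. g c *
    ((1 - tvar) * gen (over_arc D c) s + tvar * gen (under_right D c) s - gen (under_left D c) s))"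

definition rho_image :: "('a, 'c) link_diagram \<Rightarrow> ('a \<Rightarrow> laurent) set"
  where "rho_image D = rho D ` carrier (free_module (crossings D))"

definition M_red :: "('a, 'c) link_diagram \<Rightarrow> (laurent, ('a \<Rightarrow> laurent) set) module"
  where "M_red D = quotient_module (free_module (arcs D)) (rho_image D)"

definition varsigma :: "('a, 'c) link_diagram \<Rightarrow> ('a \<Rightarrow> laurent) \<Rightarrow> ('a \<Rightarrow> laurent) set"
  where "varsigma D f = rho_image D +>\<^bsub>free_module (arcs D)\<^esub> f"

text \<open>
  \<open>phi_target m\<close> is \<open>\<Lambda> \<oplus> (\<int>\<^sub>\<epsilon>)\<^bsup>m - 1\<^esup>\<close>. Its coordinates are numbered from 1 to \<open>m\<close>; the first one is
  the Laurent polynomial, the others form a function supported on \<open>{2..m}\<close>.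
\<close>

definition phi_target :: "nat \<Rightarrow> (laurent, laurent \<times> (nat \<Rightarrow> int)) module"
  where "phi_target m =
    \<lparr>carrier = {(p, n). \<forall>i. i \<notin> {2..m} \<longrightarrow> n i = 0}, monoid.mult = undefined, one = undefined,
     ring.zero = (0, \<lambda>i. 0), add = (\<lambda>(p, n) (q, k). (p + q, \<lambda>i. n i + k i)),
     module.smult = (\<lambda>r (p, n). (r * p, \<lambda>i. augmentation r * n i))\<rparr>"

definition phi_gen :: "('a, 'c) link_diagram \<Rightarrow> 'a \<Rightarrow> laurent \<times> (nat \<Rightarrow> int)"
  where "phi_gen D a = (1, \<lambda>i. if i = comp_of D a \<and> i > 1 then 1 else 0)"

definition phi_free :: "('a, 'c) link_diagram \<Rightarrow> ('a \<Rightarrow> laurent) \<Rightarrow> laurent \<times> (nat \<Rightarrow> int)"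
  where "phi_free D f =
    (\<Sum>a\<in>arcs D. f a * fst (phi_gen D a),
     \<lambda>i. \<Sum>a\<in>arcs D. augmentation (f a) * snd (phi_gen D a) i)"

text \<open>
  The map induced by \<open>phi_free\<close> on cosets; it is well defined and is the linear map taking the class
  of each arc \<open>a\<close> to \<open>phi_gen D a\<close>, see the lemmas \<open>phi_linear\<close>, \<open>phi_varsigma_gen\<close>
  and \<open>phi_unique\<close> below.
\<close>

definition phi :: "('a, 'c) link_diagram \<Rightarrow> ('a \<Rightarrow> laurent) set \<Rightarrow> laurent \<times> (nat \<Rightarrow> int)"
  where "phi D K = the_elem (phi_free D ` K)"

section \<open>Peripheral elements and the enhanced module\<close>

definition meridians :: "('a, 'c) link_diagram \<Rightarrow> nat \<Rightarrow> ('a \<Rightarrow> laurent) set set"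
  where "meridians D i = {K \<in> carrier (M_red D).
    \<forall>a\<in>arcs D. comp_of D a = i \<longrightarrow> phi D K = phi D (varsigma D (gen a))}"

definition under_crossings :: "('a, 'c) link_diagram \<Rightarrow> nat \<Rightarrow> 'c set"
  where "under_crossings D i = {c \<in> crossings D. comp_of D (under_right D c) = i}"

text \<open>The coefficient of the arc \<open>s\<close> in the sum of all \<open>w(c) (b\<^sub>1(c) + b\<^sub>2(c))\<close>; for a diagram it is even.\<close>

definition under_coeff :: "('a, 'c) link_diagram \<Rightarrow> nat \<Rightarrow> 'a \<Rightarrow> int"
  where "under_coeff D i s = (\<Sum>c\<in>under_crossings D i. writhe D c *
    ((if s = under_right D c then 1 else 0) + (if s = under_left D c then 1 else 0)))"

definition longitude :: "('a, 'c) link_diagram \<Rightarrow> nat \<Rightarrow> ('a \<Rightarrow> laurent) set"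
  where "longitude D i = varsigma D (\<lambda>s.
    (\<Sum>c\<in>under_crossings D i. of_int (writhe D c) * gen (over_arc D c) s)
      - of_int (under_coeff D i s div 2))"

text \<open>A module with a list of distinguished subsets and a list of distinguished elements.\<close>

type_synonym 'm enhanced = "(laurent, 'm) module \<times> 'm set list \<times> 'm list"

definition M_enr :: "('a, 'c) link_diagram \<Rightarrow> ('a \<Rightarrow> laurent) set enhanced"
  where "M_enr D = (M_red D, map (meridians D) [1..<Suc (num_comps D)],
    map (longitude D) [1..<Suc (num_comps D)])"

definition enr_isos :: "'m enhanced \<Rightarrow> 'n enhanced \<Rightarrow> ('m \<Rightarrow> 'n) set"
  where "enr_isos = (\<lambda>(M, Ms, ls) (N, Ns, ks).
    {f \<in> module_isos \<Lambda> M N. map (image f) Ms = Ns \<and> map f ls = ks})"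

section \<open>The Borromean rings\<close>

datatype borromean_arc = Arc_u | Arc_v | Arc_w | Arc_x | Arc_y | Arc_z

fun borromean_comp :: "borromean_arc \<Rightarrow> nat" where
  "borromean_comp Arc_u = 1"
| "borromean_comp Arc_v = 1"
| "borromean_comp Arc_w = 2"
| "borromean_comp Arc_x = 2"
| "borromean_comp Arc_y = 3"
| "borromean_comp Arc_z = 3"

text \<open>
  A crossing is named by its triple \<open>(a(c), b\<^sub>1(c), b\<^sub>2(c))\<close>, as no two crossings of the same diagram
  share a triple. The arcs \<open>u', \<dots>, z'\<close> of the second diagram are again called \<open>u, \<dots>, z\<close>.
\<close>

definition borromean_B :: "(borromean_arc, borromean_arc \<times> borromean_arc \<times> borromean_arc) link_diagram"
  where "borromean_B =
    \<lparr>num_comps = 3,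
     arcs = {Arc_u, Arc_v, Arc_w, Arc_x, Arc_y, Arc_z},
     crossings =
       {(Arc_y, Arc_u, Arc_v), (Arc_u, Arc_w, Arc_x), (Arc_w, Arc_y, Arc_z),
        (Arc_z, Arc_u, Arc_v), (Arc_v, Arc_w, Arc_x), (Arc_x, Arc_y, Arc_z)},
     comp_of = borromean_comp,
     over_arc = (\<lambda>(a, b1, b2). a), under_right = (\<lambda>(a, b1, b2). b1), under_left = (\<lambda>(a, b1, b2). b2),
     writhe = (\<lambda>c. if c \<in> {(Arc_y, Arc_u, Arc_v), (Arc_u, Arc_w, Arc_x), (Arc_w, Arc_y, Arc_z)}
       then 1 else -1)\<rparr>"

definition borromean_B' :: "(borromean_arc, borromean_arc \<times> borromean_arc \<times> borromean_arc) link_diagram"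
  where "borromean_B' =
    \<lparr>num_comps = 3,
     arcs = {Arc_u, Arc_v, Arc_w, Arc_x, Arc_y, Arc_z},
     crossings =
       {(Arc_y, Arc_u, Arc_v), (Arc_u, Arc_w, Arc_x), (Arc_w, Arc_y, Arc_z),
        (Arc_z, Arc_u, Arc_v), (Arc_v, Arc_w, Arc_x), (Arc_x, Arc_y, Arc_z)},
     comp_of = borromean_comp,
     over_arc = (\<lambda>(a, b1, b2). a), under_right = (\<lambda>(a, b1, b2). b1), under_left = (\<lambda>(a, b1, b2). b2),
     writhe = (\<lambda>c. if c \<in> {(Arc_y, Arc_u, Arc_v), (Arc_u, Arc_w, Arc_x), (Arc_w, Arc_y, Arc_z)}
       then -1 else 1)\<rparr>"

section \<open>Well-definedness\<close>

lemma augmentation_superset: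
  assumes "finite S" "Poly_Mapping.keys p \<subseteq> S"
  shows "augmentation p = (\<Sum>k\<in>S. Poly_Mapping.lookup p k)"
  unfolding augmentation_def
  by (rule sum.mono_neutral_left) (use assms in \<open>auto simp: in_keys_iff\<close>)

lemma augmentation_add: "augmentation (p + q) = augmentation p + augmentation q"
proof -
  let ?S = "Poly_Mapping.keys p \<union> Poly_Mapping.keys q"
  have "Poly_Mapping.keys (p + q) \<subseteq> ?S"
    by (rule Poly_Mapping.keys_add)
  then show ?thesis
    by (simp add: augmentation_superset[of ?S] lookup_add sum.distrib)
qed

lemma augmentation_zero [simp]: "augmentation 0 = 0"
  by (simp add: augmentation_def)

lemma augmentation_single [simp]: "augmentation (Poly_Mapping.single k n) = n"
  by (simp add: augmentation_def)

lemma augmentation_one [simp]: "augmentation 1 = 1"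
  by (simp add: augmentation_def)

lemma augmentation_tvar [simp]: "augmentation tvar = 1"
  by (simp add: tvar_def)

lemma augmentation_uminus: "augmentation (- p) = - augmentation p"
  by (metis add_eq_0_iff augmentation_add augmentation_zero)

lemma augmentation_diff: "augmentation (p - q) = augmentation p - augmentation q"
  by (metis add_diff_cancel diff_add_cancel augmentation_add)

lemma augmentation_sum: "augmentation (\<Sum>i\<in>I. f i) = (\<Sum>i\<in>I. augmentation (f i))"
  by (induction I rule: infinite_finite_induct) (auto simp: augmentation_add)

lemma poly_mapping_sum_singles:
  "p = (\<Sum>k\<in>Poly_Mapping.keys p. Poly_Mapping.single k (Poly_Mapping.lookup p k))" for p :: laurent
  by (rule poly_mapping_eqI)
    (auto simp: lookup_sum lookup_single when_def in_keys_iff)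

lemma augmentation_mult: "augmentation (p * q) = augmentation p * augmentation q"
proof -
  have "p * q = (\<Sum>k\<in>Poly_Mapping.keys p. \<Sum>l\<in>Poly_Mapping.keys q.
      Poly_Mapping.single (k + l) (Poly_Mapping.lookup p k * Poly_Mapping.lookup q l))"
    by (subst poly_mapping_sum_singles[of p], subst poly_mapping_sum_singles[of q])
      (simp add: sum_product mult_single)
  then have "augmentation (p * q) = (\<Sum>k\<in>Poly_Mapping.keys p. \<Sum>l\<in>Poly_Mapping.keys q.
      Poly_Mapping.lookup p k * Poly_Mapping.lookup q l)"
    by (simp add: augmentation_sum)
  also have "\<dots> = augmentation p * augmentation q"
    by (simp add: augmentation_def sum_product)
  finally show ?thesis .
qed

lemma carrier_Lambda [simp]: "carrier \<Lambda> = UNIV"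
  by (simp add: ring_of_type_algebra_def)

lemma free_module_module: "Module.module \<Lambda> (free_module S)"
proof (rule Module.moduleI)
  show "cring \<Lambda>"
    by (rule cring_from_type_algebra)
  show "abelian_group (free_module S)"
  proof (rule abelian_groupI)
    fix x assume "x \<in> carrier (free_module S)"
    then show "\<exists>y\<in>carrier (free_module S). y \<oplus>\<^bsub>free_module S\<^esub> x = \<zero>\<^bsub>free_module S\<^esub>"
      by (intro bexI[of _ "\<lambda>s. - x s"]) (auto simp: free_module_def)
  qed (auto simp: free_module_def algebra_simps)
qed (auto simp: free_module_def ring_of_type_algebra_def algebra_simps)

lemma phi_target_module: "Module.module \<Lambda> (phi_target m)"
proof (rule Module.moduleI)
  show "cring \<Lambda>"
    by (rule cring_from_type_algebra)
  show "abelian_group (phi_target m)"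
  proof (rule abelian_groupI)
    fix x assume "x \<in> carrier (phi_target m)"
    then show "\<exists>y\<in>carrier (phi_target m). y \<oplus>\<^bsub>phi_target m\<^esub> x = \<zero>\<^bsub>phi_target m\<^esub>"
      by (intro bexI[of _ "(- fst x, \<lambda>i. - snd x i)"]) (auto simp: phi_target_def)
  qed (auto simp: phi_target_def algebra_simps)
qed (auto simp: phi_target_def ring_of_type_algebra_def algebra_simps augmentation_add
    augmentation_mult)

lemma smult_quotient_module:
  assumes M: "Module.module R M" and N: "submodule N R M"
    and r: "r \<in> carrier R" and x: "x \<in> carrier M"
  shows "r \<odot>\<^bsub>quotient_module M N\<^esub> (N +>\<^bsub>M\<^esub> x) = N +>\<^bsub>M\<^esub> (r \<odot>\<^bsub>M\<^esub> x)"
proof -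
  interpret Module.module R M by fact
  interpret N: submodule N R M by fact
  interpret N: abelian_subgroup N M
    by (rule abelian_subgroupI2[OF M.a_comm_group]) (rule N.subgroup_axioms)
  have const: "N +>\<^bsub>M\<^esub> (r \<odot>\<^bsub>M\<^esub> y) = N +>\<^bsub>M\<^esub> (r \<odot>\<^bsub>M\<^esub> x)" if "y \<in> N +>\<^bsub>M\<^esub> x" for y
  proof -
    from that obtain n where n: "n \<in> N" "y = n \<oplus>\<^bsub>M\<^esub> x"
      by (auto simp: a_r_coset_def')
    have "r \<odot>\<^bsub>M\<^esub> y = r \<odot>\<^bsub>M\<^esub> n \<oplus>\<^bsub>M\<^esub> r \<odot>\<^bsub>M\<^esub> x"
      using n r x N.a_Hcarr by (simp add: smult_r_distr)
    moreover have "r \<odot>\<^bsub>M\<^esub> n \<in> N"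
      using n r by simp
    ultimately have "r \<odot>\<^bsub>M\<^esub> y \<in> N +>\<^bsub>M\<^esub> (r \<odot>\<^bsub>M\<^esub> x)"
      by (auto simp: a_r_coset_def')
    then show ?thesis
      using N.a_repr_independence'[of "r \<odot>\<^bsub>M\<^esub> y" "r \<odot>\<^bsub>M\<^esub> x"] r x by simp
  qed
  have "x \<in> N +>\<^bsub>M\<^esub> x"
    using x by (rule N.a_rcos_self)
  then have "(\<Union>y\<in>N +>\<^bsub>M\<^esub> x. N +>\<^bsub>M\<^esub> (r \<odot>\<^bsub>M\<^esub> y)) = N +>\<^bsub>M\<^esub> (r \<odot>\<^bsub>M\<^esub> x)"
    by (subst SUP_cong[OF refl const]) (assumption, rule cSUP_const, blast)
  then show ?thesis
    by (simp add: quotient_module_def)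
qed

lemma quotient_module_module:
  assumes M: "Module.module R M" and N: "submodule N R M"
  shows "Module.module R (quotient_module M N)"
proof -
  interpret Module.module R M by fact
  interpret N: submodule N R M by fact
  interpret N: abelian_subgroup N M
    by (rule abelian_subgroupI2[OF M.a_comm_group]) (rule N.subgroup_axioms)
  let ?Q = "quotient_module M N"
  have rep: "\<exists>x\<in>carrier M. K = N +>\<^bsub>M\<^esub> x" if "K \<in> carrier ?Q" for K
    using that by (auto simp: quotient_module_def A_RCOSETS_def RCOSETS_def a_r_coset_def)
  have cl: "N +>\<^bsub>M\<^esub> x \<in> carrier ?Q" if "x \<in> carrier M" for x
    using that by (auto simp: quotient_module_def A_RCOSETS_def RCOSETS_def a_r_coset_def)
  have add: "(N +>\<^bsub>M\<^esub> x) \<oplus>\<^bsub>?Q\<^esub> (N +>\<^bsub>M\<^esub> y) = N +>\<^bsub>M\<^esub> (x \<oplus>\<^bsub>M\<^esub> y)"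
    if "x \<in> carrier M" "y \<in> carrier M" for x y
    using N.a_rcos_sum[OF that] by (simp add: quotient_module_def)
  note sm = smult_quotient_module[OF M N]
  have zero: "\<zero>\<^bsub>?Q\<^esub> = N +>\<^bsub>M\<^esub> \<zero>\<^bsub>M\<^esub>"
    using M.a_coset_add_zero[OF N.a_subset] by (simp add: quotient_module_def)
  have ab: "abelian_group ?Q"
  proof (rule abelian_groupI)
    fix K assume "K \<in> carrier ?Q"
    then obtain x where x: "x \<in> carrier M" "K = N +>\<^bsub>M\<^esub> x"
      using rep by blast
    then show "\<exists>L\<in>carrier ?Q. L \<oplus>\<^bsub>?Q\<^esub> K = \<zero>\<^bsub>?Q\<^esub>"
      by (intro bexI[of _ "N +>\<^bsub>M\<^esub> (\<ominus>\<^bsub>M\<^esub> x)"]) (auto simp: add zero cl M.l_neg)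
    show "\<zero>\<^bsub>?Q\<^esub> \<oplus>\<^bsub>?Q\<^esub> K = K"
      using x by (simp add: zero add)
  next
    fix K L assume KL: "K \<in> carrier ?Q" "L \<in> carrier ?Q"
    obtain x y where "x \<in> carrier M" "K = N +>\<^bsub>M\<^esub> x" "y \<in> carrier M" "L = N +>\<^bsub>M\<^esub> y"
      using rep[OF KL(1)] rep[OF KL(2)] by auto
    then show "K \<oplus>\<^bsub>?Q\<^esub> L \<in> carrier ?Q" "K \<oplus>\<^bsub>?Q\<^esub> L = L \<oplus>\<^bsub>?Q\<^esub> K"
      by (simp_all add: add cl M.a_comm)
  next
    fix K L P assume KLP: "K \<in> carrier ?Q" "L \<in> carrier ?Q" "P \<in> carrier ?Q"
    obtain x y z where "x \<in> carrier M" "K = N +>\<^bsub>M\<^esub> x" "y \<in> carrier M" "L = N +>\<^bsub>M\<^esub> y"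
        "z \<in> carrier M" "P = N +>\<^bsub>M\<^esub> z"
      using rep[OF KLP(1)] rep[OF KLP(2)] rep[OF KLP(3)] by auto
    then show "(K \<oplus>\<^bsub>?Q\<^esub> L) \<oplus>\<^bsub>?Q\<^esub> P = K \<oplus>\<^bsub>?Q\<^esub> (L \<oplus>\<^bsub>?Q\<^esub> P)"
      by (simp add: add M.a_assoc)
  next
    show "\<zero>\<^bsub>?Q\<^esub> \<in> carrier ?Q"
      by (simp add: zero cl)
  qed
  show ?thesis
  proof (rule Module.moduleI)
    show "cring R" by (rule R.is_cring)
    show "abelian_group ?Q" by (rule ab)
  next
    fix a K assume "a \<in> carrier R" "K \<in> carrier ?Q"
    then show "a \<odot>\<^bsub>?Q\<^esub> K \<in> carrier ?Q"
      using rep[of K] by (auto simp: sm cl)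
  next
    fix a b K assume "a \<in> carrier R" "b \<in> carrier R" "K \<in> carrier ?Q"
    then show "(a \<oplus>\<^bsub>R\<^esub> b) \<odot>\<^bsub>?Q\<^esub> K = a \<odot>\<^bsub>?Q\<^esub> K \<oplus>\<^bsub>?Q\<^esub> b \<odot>\<^bsub>?Q\<^esub> K"
      using rep[of K] by (auto simp: sm add smult_l_distr)
  next
    fix a K L assume "a \<in> carrier R" "K \<in> carrier ?Q" "L \<in> carrier ?Q"
    then show "a \<odot>\<^bsub>?Q\<^esub> (K \<oplus>\<^bsub>?Q\<^esub> L) = a \<odot>\<^bsub>?Q\<^esub> K \<oplus>\<^bsub>?Q\<^esub> a \<odot>\<^bsub>?Q\<^esub> L"
      using rep[of K] rep[of L] by (auto simp: sm add smult_r_distr)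
  next
    fix a b K assume "a \<in> carrier R" "b \<in> carrier R" "K \<in> carrier ?Q"
    then show "(a \<otimes>\<^bsub>R\<^esub> b) \<odot>\<^bsub>?Q\<^esub> K = a \<odot>\<^bsub>?Q\<^esub> (b \<odot>\<^bsub>?Q\<^esub> K)"
      using rep[of K] by (auto simp: sm smult_assoc1)
  next
    fix K assume "K \<in> carrier ?Q"
    then show "\<one>\<^bsub>R\<^esub> \<odot>\<^bsub>?Q\<^esub> K = K"
      using rep[of K] by (auto simp: sm)
  qed
qed

lemma rho_linear:
  assumes "wf_diagram D"
  shows "rho D \<in> linear_maps \<Lambda> (free_module (crossings D)) (free_module (arcs D))"
proof -
  have "gen (over_arc D c) s = 0 \<and> gen (under_right D c) s = 0 \<and> gen (under_left D c) s = 0"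
    if "c \<in> crossings D" "s \<notin> arcs D" for c s
    using assms that by (auto simp: wf_diagram_def gen_def)
  then show ?thesis
    by (auto simp: linear_maps_def free_module_def rho_def fun_eq_iff distrib_right sum.distrib
        sum_distrib_left mult.assoc intro!: sum.neutral)
qed

lemma rho_gen:
  assumes "wf_diagram D" "c \<in> crossings D"
  shows "rho D (gen c) = (\<lambda>s. (1 - tvar) * gen (over_arc D c) s + tvar * gen (under_right D c) s
    - gen (under_left D c) s)"
proof
  fix s
  let ?h = "\<lambda>c. (1 - tvar) * gen (over_arc D c) s + tvar * gen (under_right D c) s
    - gen (under_left D c) s"
  have "rho D (gen c) s = (\<Sum>d\<in>crossings D. if d = c then ?h d else 0)"
    unfolding rho_def by (rule sum.cong) (auto simp: gen_def)
  also have "\<dots> = ?h c"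
    using assms by (simp add: wf_diagram_def)
  finally show "rho D (gen c) s = ?h c" .
qed

lemma rho_image_submodule:
  assumes "wf_diagram D"
  shows "submodule (rho_image D) \<Lambda> (free_module (arcs D))"
proof -
  let ?C = "free_module (crossings D)" and ?A = "free_module (arcs D)"
  interpret C: Module.module \<Lambda> ?C by (rule free_module_module)
  interpret A: Module.module \<Lambda> ?A by (rule free_module_module)
  have cl: "rho D g \<in> carrier ?A" if "g \<in> carrier ?C" for g
    using rho_linear[OF assms] that by (auto simp: linear_maps_def)
  have add: "rho D (g \<oplus>\<^bsub>?C\<^esub> h) = rho D g \<oplus>\<^bsub>?A\<^esub> rho D h"
    if "g \<in> carrier ?C" "h \<in> carrier ?C" for g h
    using rho_linear[OF assms] that by (auto simp: linear_maps_def)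
  have sm: "rho D (r \<odot>\<^bsub>?C\<^esub> g) = r \<odot>\<^bsub>?A\<^esub> rho D g" if "g \<in> carrier ?C" for r g
    using rho_linear[OF assms] that by (auto simp: linear_maps_def)
  show ?thesis
  proof (rule A.submoduleI)
    show sub: "rho_image D \<subseteq> carrier ?A"
      using cl by (auto simp: rho_image_def)
    show zero: "\<zero>\<^bsub>?A\<^esub> \<in> rho_image D"
      unfolding rho_image_def
      by (rule image_eqI[of _ _ "\<zero>\<^bsub>?C\<^esub>"]) (simp_all add: rho_def free_module_def)
    show smc: "r \<odot>\<^bsub>?A\<^esub> x \<in> rho_image D" if "x \<in> rho_image D" for r x
      using that unfolding rho_image_def by (auto simp flip: sm)
    show "\<ominus>\<^bsub>?A\<^esub> x \<in> rho_image D" if "x \<in> rho_image D" for x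
    proof -
      have "\<ominus>\<^bsub>?A\<^esub> x = (\<ominus>\<^bsub>\<Lambda>\<^esub> \<one>\<^bsub>\<Lambda>\<^esub>) \<odot>\<^bsub>?A\<^esub> x"
        using that sub by (subst A.smult_l_minus) auto
      then show ?thesis
        using smc[OF that] by simp
    qed
    show "x \<oplus>\<^bsub>?A\<^esub> y \<in> rho_image D" if "x \<in> rho_image D" "y \<in> rho_image D" for x y
      using that unfolding rho_image_def by (auto simp flip: add)
  qed
qed

lemma M_red_module:
  assumes "wf_diagram D"
  shows "Module.module \<Lambda> (M_red D)"
  unfolding M_red_def
  by (intro quotient_module_module free_module_module rho_image_submodule assms)

lemma carrier_M_red: "carrier (M_red D) = varsigma D ` carrier (free_module (arcs D))"
  by (auto simp: M_red_def quotient_module_def varsigma_def A_RCOSETS_def RCOSETS_def a_r_coset_def)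

lemma varsigma_linear:
  assumes "wf_diagram D"
  shows "varsigma D \<in> linear_maps \<Lambda> (free_module (arcs D)) (M_red D)"
proof -
  let ?A = "free_module (arcs D)"
  interpret A: Module.module \<Lambda> ?A by (rule free_module_module)
  interpret N: submodule "rho_image D" \<Lambda> ?A by (rule rho_image_submodule[OF assms])
  interpret N: abelian_subgroup "rho_image D" ?A
    by (rule abelian_subgroupI2[OF A.M.a_comm_group]) (rule N.subgroup_axioms)
  have "varsigma D (x \<oplus>\<^bsub>?A\<^esub> y) = varsigma D x \<oplus>\<^bsub>M_red D\<^esub> varsigma D y"
    if "x \<in> carrier ?A" "y \<in> carrier ?A" for x y
    using N.a_rcos_sum[OF that] by (simp add: varsigma_def M_red_def quotient_module_def)
  moreover have "varsigma D (r \<odot>\<^bsub>?A\<^esub> x) = r \<odot>\<^bsub>M_red D\<^esub> varsigma D x"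
    if "x \<in> carrier ?A" for r x
    using smult_quotient_module[OF free_module_module rho_image_submodule[OF assms], of r x] that
    by (simp add: varsigma_def M_red_def)
  ultimately show ?thesis
    by (auto simp: linear_maps_def carrier_M_red)
qed

lemma gen_in_free [simp]: "a \<in> S \<Longrightarrow> gen a \<in> carrier (free_module S)"
  by (auto simp: free_module_def gen_def)

lemma phi_free_linear:
  assumes "wf_diagram D"
  shows "phi_free D \<in> linear_maps \<Lambda> (free_module (arcs D)) (phi_target (num_comps D))"
proof -
  have "1 \<le> comp_of D a \<and> comp_of D a \<le> num_comps D" if "a \<in> arcs D" for a
    using assms that unfolding wf_diagram_def by (metis atLeastAtMost_iff imageI)
  then have "snd (phi_gen D a) i = 0" if "a \<in> arcs D" "i \<notin> {2..num_comps D}" for a i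
    using that by (force simp: phi_gen_def)
  then show ?thesis
    by (auto simp: linear_maps_def phi_free_def phi_target_def free_module_def fun_eq_iff
        augmentation_add augmentation_mult sum.distrib sum_distrib_left algebra_simps
        intro!: sum.neutral)
qed

lemma phi_free_gen:
  assumes "wf_diagram D" "a \<in> arcs D"
  shows "phi_free D (gen a) = phi_gen D a"
proof -
  have fin: "finite (arcs D)"
    using assms by (simp add: wf_diagram_def)
  have 1: "(\<Sum>b\<in>arcs D. gen a b * fst (phi_gen D b)) = fst (phi_gen D a)"
  proof -
    have "(\<Sum>b\<in>arcs D. gen a b * fst (phi_gen D b))
        = (\<Sum>b\<in>arcs D. if b = a then fst (phi_gen D b) else 0)"
      by (rule sum.cong) (auto simp: gen_def)
    then show ?thesis using fin assms by simp
  qed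
  have 2: "(\<Sum>b\<in>arcs D. augmentation (gen a b) * snd (phi_gen D b) i) = snd (phi_gen D a) i" for i
  proof -
    have "(\<Sum>b\<in>arcs D. augmentation (gen a b) * snd (phi_gen D b) i)
        = (\<Sum>b\<in>arcs D. if b = a then snd (phi_gen D b) i else 0)"
      by (rule sum.cong) (auto simp: gen_def)
    then show ?thesis using fin assms by simp
  qed
  show ?thesis
    by (simp add: phi_free_def 1 2)
qed

lemma phi_free_rho:
  assumes D: "wf_diagram D"
  shows "phi_free D (rho D g) = (0, \<lambda>i. 0)"
proof -
  have fin: "finite (arcs D)"
    using D by (simp add: wf_diagram_def)
  have gsum: "(\<Sum>s\<in>arcs D. gen a s) = 1" if "a \<in> arcs D" for a
    unfolding gen_def using fin that by simp
  have asum: "(\<Sum>s\<in>arcs D. augmentation (gen a s) * h s) = h a" if "a \<in> arcs D" for a h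
  proof -
    have "(\<Sum>s\<in>arcs D. augmentation (gen a s) * h s) = (\<Sum>s\<in>arcs D. if s = a then h s else 0)"
      by (rule sum.cong) (auto simp: gen_def)
    then show ?thesis using fin that by simp
  qed
  have "(\<Sum>s\<in>arcs D. rho D g s * fst (phi_gen D s)) = 0"
  proof -
    have "(\<Sum>s\<in>arcs D. rho D g s * fst (phi_gen D s)) = (\<Sum>c\<in>crossings D. g c *
        ((1 - tvar) * (\<Sum>s\<in>arcs D. gen (over_arc D c) s)
          + tvar * (\<Sum>s\<in>arcs D. gen (under_right D c) s)
          - (\<Sum>s\<in>arcs D. gen (under_left D c) s)))"
      unfolding rho_def phi_gen_def fst_conv mult_1_right
      by (subst sum.swap)
        (simp add: sum_distrib_left sum.distrib sum_subtractf algebra_simps)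
    also have "\<dots> = 0"
      by (rule sum.neutral) (use D in \<open>auto simp: wf_diagram_def gsum\<close>)
    finally show ?thesis .
  qed
  moreover have "(\<Sum>s\<in>arcs D. augmentation (rho D g s) * snd (phi_gen D s) i) = 0" for i
  proof -
    let ?h = "\<lambda>s. snd (phi_gen D s) i"
    have "(\<Sum>s\<in>arcs D. augmentation (rho D g s) * ?h s) = (\<Sum>c\<in>crossings D. augmentation (g c) *
        ((\<Sum>s\<in>arcs D. augmentation (gen (under_right D c) s) * ?h s)
          - (\<Sum>s\<in>arcs D. augmentation (gen (under_left D c) s) * ?h s)))"
      unfolding rho_def augmentation_sum sum_distrib_right
      by (subst sum.swap)
        (simp add: augmentation_mult augmentation_add augmentation_diff sum_distrib_left
          sum_subtractf algebra_simps)
    also have "\<dots> = 0"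
      by (rule sum.neutral) (use D in \<open>auto simp: wf_diagram_def asum phi_gen_def\<close>)
    finally show ?thesis .
  qed
  ultimately show ?thesis
    by (simp add: phi_free_def)
qed

lemma phi_varsigma:
  assumes D: "wf_diagram D" and f: "f \<in> carrier (free_module (arcs D))"
  shows "phi D (varsigma D f) = phi_free D f"
proof -
  let ?A = "free_module (arcs D)"
  interpret A: Module.module \<Lambda> ?A by (rule free_module_module)
  interpret N: submodule "rho_image D" \<Lambda> ?A by (rule rho_image_submodule[OF D])
  have "phi_free D (n \<oplus>\<^bsub>?A\<^esub> f) = phi_free D f" if "n \<in> rho_image D" for n
  proof -
    have "n \<in> carrier ?A"
      using that N.subset by auto
    then have "phi_free D (n \<oplus>\<^bsub>?A\<^esub> f) =
        phi_free D n \<oplus>\<^bsub>phi_target (num_comps D)\<^esub> phi_free D f"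
      using phi_free_linear[OF D] f by (auto simp: linear_maps_def)
    moreover have "phi_free D n = (0, \<lambda>i. 0)"
      using that phi_free_rho[OF D] by (auto simp: rho_image_def)
    ultimately show ?thesis
      by (cases "phi_free D f") (simp add: phi_target_def)
  qed
  moreover have "rho_image D \<noteq> {}"
    using N.one_closed by auto
  ultimately have "phi_free D ` varsigma D f = {phi_free D f}"
    by (auto simp: varsigma_def a_r_coset_def' image_UN)
  then show ?thesis
    by (simp add: phi_def)
qed

theorem phi_varsigma_gen:
  assumes "wf_diagram D" "a \<in> arcs D"
  shows "phi D (varsigma D (gen a)) = phi_gen D a"
  using assms by (simp add: phi_varsigma phi_free_gen)

theorem phi_linear:
  assumes D: "wf_diagram D"
  shows "phi D \<in> linear_maps \<Lambda> (M_red D) (phi_target (num_comps D))"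
proof -
  let ?A = "free_module (arcs D)" and ?T = "phi_target (num_comps D)"
  interpret A: Module.module \<Lambda> ?A by (rule free_module_module)
  have 1: "varsigma D x \<oplus>\<^bsub>M_red D\<^esub> varsigma D y = varsigma D (x \<oplus>\<^bsub>?A\<^esub> y)"
    if "x \<in> carrier ?A" "y \<in> carrier ?A" for x y
    using varsigma_linear[OF D] that by (auto simp: linear_maps_def)
  have 2: "r \<odot>\<^bsub>M_red D\<^esub> varsigma D x = varsigma D (r \<odot>\<^bsub>?A\<^esub> x)"
    if "x \<in> carrier ?A" for r x
    using varsigma_linear[OF D] that by (auto simp: linear_maps_def)
  show ?thesis
    using phi_free_linear[OF D]
    by (auto simp: linear_maps_def carrier_M_red 1 2 phi_varsigma[OF D] Pi_iff)
qed

lemma free_linear_unique: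
  assumes N: "Module.module \<Lambda> N" and S: "finite S"
    and f: "f \<in> linear_maps \<Lambda> (free_module S) N" and g: "g \<in> linear_maps \<Lambda> (free_module S) N"
    and eq: "\<And>a. a \<in> S \<Longrightarrow> f (gen a) = g (gen a)"
    and x: "x \<in> carrier (free_module S)"
  shows "f x = g x"
proof -
  interpret A: Module.module \<Lambda> "free_module S" by (rule free_module_module)
  interpret N: Module.module \<Lambda> N by fact
  have fadd: "h (x \<oplus>\<^bsub>free_module S\<^esub> y) = h x \<oplus>\<^bsub>N\<^esub> h y"
    if "h \<in> linear_maps \<Lambda> (free_module S) N" "x \<in> carrier (free_module S)"
      "y \<in> carrier (free_module S)" for h x y
    using that by (auto simp: linear_maps_def)
  have fsm: "h (r \<odot>\<^bsub>free_module S\<^esub> x) = r \<odot>\<^bsub>N\<^esub> h x"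
    if "h \<in> linear_maps \<Lambda> (free_module S) N" "x \<in> carrier (free_module S)" for h r x
    using that by (auto simp: linear_maps_def)
  have *: "f (\<lambda>s. if s \<in> T then x s else 0) = g (\<lambda>s. if s \<in> T then x s else 0)" if "T \<subseteq> S" for T
    using finite_subset[OF that S] that
  proof (induction T rule: finite_induct)
    case empty
    have z: "(\<lambda>s. 0) = \<zero>\<^bsub>\<Lambda>\<^esub> \<odot>\<^bsub>free_module S\<^esub> (\<lambda>s. 0)"
      by (simp add: free_module_def)
    have z0: "(\<lambda>s. 0) \<in> carrier (free_module S)"
      by (simp add: free_module_def)
    have "h (\<lambda>s. 0) = \<zero>\<^bsub>N\<^esub>" if h: "h \<in> linear_maps \<Lambda> (free_module S) N" for h
    proof -
      have "h (\<lambda>s. 0) \<in> carrier N"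
        using h z0 by (auto simp: linear_maps_def)
      then show ?thesis
        by (subst z, subst fsm[OF h z0]) simp
    qed
    from this[OF f] this[OF g] show ?case
      by simp
  next
    case (insert a T)
    let ?r = "\<lambda>s. if s \<in> T then x s else 0"
    have split: "(\<lambda>s. if s \<in> insert a T then x s else 0)
        = (x a \<odot>\<^bsub>free_module S\<^esub> gen a) \<oplus>\<^bsub>free_module S\<^esub> ?r"
      using insert.hyps by (auto simp: free_module_def gen_def)
    have r: "?r \<in> carrier (free_module S)"
      using insert.prems by (auto simp: free_module_def)
    have a: "gen a \<in> carrier (free_module S)"
      using insert.prems by simp
    then have xa: "x a \<odot>\<^bsub>free_module S\<^esub> gen a \<in> carrier (free_module S)"
      by simp
    have "f ?r = g ?r"
      using insert by auto
    moreover have "f (gen a) = g (gen a)"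
      using insert.prems eq by auto
    ultimately show ?case
      unfolding split by (simp only: fadd[OF f xa r] fadd[OF g xa r] fsm[OF f a] fsm[OF g a])
  qed
  have "(\<lambda>s. if s \<in> S then x s else 0) = x"
    using x by (auto simp: free_module_def)
  then show ?thesis
    using *[of S] by simp
qed

theorem phi_unique:
  assumes D: "wf_diagram D"
    and f: "f \<in> linear_maps \<Lambda> (M_red D) (phi_target (num_comps D))"
    and gens: "\<And>a. a \<in> arcs D \<Longrightarrow> f (varsigma D (gen a)) = phi_gen D a"
    and K: "K \<in> carrier (M_red D)"
  shows "f K = phi D K"
proof -
  let ?A = "free_module (arcs D)" and ?T = "phi_target (num_comps D)"
  obtain x where x: "x \<in> carrier ?A" "K = varsigma D x"
    using K by (auto simp: carrier_M_red)
  have comp: "(\<lambda>y. h (varsigma D y)) \<in> linear_maps \<Lambda> ?A ?T"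
    if "h \<in> linear_maps \<Lambda> (M_red D) ?T" for h
    using that varsigma_linear[OF D] by (auto simp: linear_maps_def Pi_iff)
  have "finite (arcs D)"
    using D by (simp add: wf_diagram_def)
  from free_linear_unique[OF phi_target_module this comp[OF f] comp[OF phi_linear[OF D]] _ x(1)]
  show ?thesis
    using gens phi_varsigma_gen[OF D] x by simp
qed

lemma wf_borromean: "wf_diagram borromean_B" "wf_diagram borromean_B'"
  by (auto simp: wf_diagram_def borromean_B_def borromean_B'_def)

text \<open>Each arc ends at one underpass and begins at another one, and here their writhes cancel.\<close>

lemma under_coeff_borromean:
  assumes "i \<in> {1, 2, 3}"
  shows "under_coeff borromean_B i s = 0" "under_coeff borromean_B' i s = 0"
proof -
  have "under_crossings borromean_B 1 = {(Arc_y, Arc_u, Arc_v), (Arc_z, Arc_u, Arc_v)}"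
    "under_crossings borromean_B 2 = {(Arc_u, Arc_w, Arc_x), (Arc_v, Arc_w, Arc_x)}"
    "under_crossings borromean_B 3 = {(Arc_w, Arc_y, Arc_z), (Arc_x, Arc_y, Arc_z)}"
    by (auto simp: under_crossings_def borromean_B_def)
  then show "under_coeff borromean_B i s = 0"
    using assms by (auto simp: under_coeff_def borromean_B_def)
  have "under_crossings borromean_B' 1 = {(Arc_y, Arc_u, Arc_v), (Arc_z, Arc_u, Arc_v)}"
    "under_crossings borromean_B' 2 = {(Arc_u, Arc_w, Arc_x), (Arc_v, Arc_w, Arc_x)}"
    "under_crossings borromean_B' 3 = {(Arc_w, Arc_y, Arc_z), (Arc_x, Arc_y, Arc_z)}"
    by (auto simp: under_crossings_def borromean_B'_def)
  then show "under_coeff borromean_B' i s = 0"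
    using assms by (auto simp: under_coeff_def borromean_B'_def)
qed

end

theory Submission
  imports Defs
begin

text \<open>
  The two diagrams have the same reduced Alexander module and the same meridians, while their
  first longitudes \<open>y - z\<close> and \<open>z - y\<close> are opposite. Multiplication by \<open>1 - t\<close> annihilates the
  kernel of \<open>\<phi>\<close>, so a linear map preserving the meridians of \<open>K\<^sub>2\<close> and \<open>K\<^sub>3\<close> fixes both
  \<open>(1 - t) w\<close> and \<open>(1 - t) y\<close>; hence it fixes their difference, which is \<open>y - z\<close>. But \<open>y - z\<close> is
  not 2-torsion: sending \<open>u, v, w, x, y, z\<close> to \<open>0, 1 - t, 0, 0, 1, t\<close> defines a linear map to
  \<open>\<Lambda> / (1 - t)\<^sup>2\<close>, and taking derivatives at \<open>t = 1\<close> detects \<open>2 (1 - t)\<close> in the target.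
\<close>

section \<open>Derivatives at 1 of Laurent polynomials\<close>

text \<open>This is p'(1). Together with \<open>augmentation p\<close> = p(1) it determines p modulo
  (1 - t)^2, so no quotient ring has to be built.\<close>

definition deriv_at_1 :: "laurent \<Rightarrow> int"
  where "deriv_at_1 p = (\<Sum>k\<in>Poly_Mapping.keys p. k * Poly_Mapping.lookup p k)"

lemma deriv_at_1_superset:
  assumes "finite S" "Poly_Mapping.keys p \<subseteq> S"
  shows "deriv_at_1 p = (\<Sum>k\<in>S. k * Poly_Mapping.lookup p k)"
  unfolding deriv_at_1_def
  by (rule sum.mono_neutral_left) (use assms in \<open>auto simp: in_keys_iff\<close>)

lemma deriv_at_1_add: "deriv_at_1 (p + q) = deriv_at_1 p + deriv_at_1 q"
proof -
  let ?S = "Poly_Mapping.keys p \<union> Poly_Mapping.keys q"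
  have "Poly_Mapping.keys (p + q) \<subseteq> ?S"
    by (rule Poly_Mapping.keys_add)
  then show ?thesis
    by (simp add: deriv_at_1_superset[of ?S] lookup_add sum.distrib algebra_simps)
qed

lemma deriv_at_1_single [simp]: "deriv_at_1 (Poly_Mapping.single k n) = k * n"
  by (simp add: deriv_at_1_def)

lemma deriv_at_1_zero [simp]: "deriv_at_1 0 = 0"
  by (simp add: deriv_at_1_def)

lemma deriv_at_1_one [simp]: "deriv_at_1 1 = 0"
  by (simp add: deriv_at_1_def)

lemma deriv_at_1_tvar [simp]: "deriv_at_1 tvar = 1"
  by (simp add: tvar_def)

lemma deriv_at_1_2 [simp]: "deriv_at_1 2 = 0"
  using deriv_at_1_add[of 1 1] by simp

lemma augmentation_2 [simp]: "augmentation 2 = 2"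
  using augmentation_add[of 1 1] by simp

lemma deriv_at_1_diff: "deriv_at_1 (p - q) = deriv_at_1 p - deriv_at_1 q"
  by (metis add_diff_cancel diff_add_cancel deriv_at_1_add)

lemma deriv_at_1_sum: "deriv_at_1 (\<Sum>i\<in>I. f i) = (\<Sum>i\<in>I. deriv_at_1 (f i))"
  by (induction I rule: infinite_finite_induct) (auto simp: deriv_at_1_add)

lemma deriv_at_1_mult:
  "deriv_at_1 (p * q) = deriv_at_1 p * augmentation q + augmentation p * deriv_at_1 q"
proof -
  have "p * q = (\<Sum>k\<in>Poly_Mapping.keys p. \<Sum>l\<in>Poly_Mapping.keys q.
      Poly_Mapping.single (k + l) (Poly_Mapping.lookup p k * Poly_Mapping.lookup q l))"
    by (subst poly_mapping_sum_singles[of p], subst poly_mapping_sum_singles[of q])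
      (simp add: sum_product mult_single)
  then have "deriv_at_1 (p * q) = (\<Sum>k\<in>Poly_Mapping.keys p. \<Sum>l\<in>Poly_Mapping.keys q.
      (k + l) * (Poly_Mapping.lookup p k * Poly_Mapping.lookup q l))"
    by (simp add: deriv_at_1_sum)
  also have "\<dots> = deriv_at_1 p * augmentation q + augmentation p * deriv_at_1 q"
    by (simp add: augmentation_def deriv_at_1_def sum_product sum.distrib algebra_simps)
      (rule sum.swap)
  finally show ?thesis .
qed

section \<open>The augmentation ideal\<close>

text \<open>Consecutive powers of t differ by a multiple of 1 - t; the induction runs in both
  directions from 0 because exponents may be negative.\<close>

lemma one_minus_tvar_dvd_single: "1 - tvar dvd Poly_Mapping.single k n - Poly_Mapping.single 0 n"
proof (induction k rule: int_induct[of _ 0])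
  case base
  show ?case by simp
next
  case (step1 i)
  have "Poly_Mapping.single (i + 1) n = Poly_Mapping.single i n * tvar"
    by (simp add: tvar_def mult_single)
  then have "Poly_Mapping.single (i + 1) n - Poly_Mapping.single 0 n
      = (Poly_Mapping.single i n - Poly_Mapping.single 0 n)
        - (1 - tvar) * Poly_Mapping.single i n"
    by (simp add: algebra_simps)
  then show ?case
    using step1 by (metis dvd_diff dvd_triv_left)
next
  case (step2 i)
  have "Poly_Mapping.single i n = Poly_Mapping.single (i - 1) n * tvar"
    by (simp add: tvar_def mult_single)
  then have "Poly_Mapping.single (i - 1) n - Poly_Mapping.single 0 n
      = (Poly_Mapping.single i n - Poly_Mapping.single 0 n)
        + (1 - tvar) * Poly_Mapping.single (i - 1) n"
    by (simp add: algebra_simps)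
  then show ?case
    using step2 by (metis dvd_add dvd_triv_left)
qed

text \<open>Moving every coefficient to exponent 0 gives the constant p(1) = 0, so p is a sum of
  differences covered by the previous lemma.\<close>

lemma one_minus_tvar_dvd:
  assumes "augmentation p = 0"
  shows "1 - tvar dvd p"
proof -
  let ?K = "Poly_Mapping.keys p" and ?l = "Poly_Mapping.lookup p"
  have "(\<Sum>k\<in>?K. Poly_Mapping.single (0::int) (?l k)) = 0"
  proof (rule poly_mapping_eqI)
    fix k :: int
    show "Poly_Mapping.lookup (\<Sum>k\<in>?K. Poly_Mapping.single (0::int) (?l k)) k
        = Poly_Mapping.lookup 0 k"
      using assms by (cases "k = 0") (simp_all add: augmentation_def lookup_sum lookup_single)
  qed
  then have "p = (\<Sum>k\<in>?K. Poly_Mapping.single k (?l k) - Poly_Mapping.single 0 (?l k))"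
    using poly_mapping_sum_singles[of p] by (simp add: sum_subtractf)
  also have "1 - tvar dvd \<dots>"
    by (intro dvd_sum one_minus_tvar_dvd_single)
  finally show ?thesis .
qed

section \<open>Classes of vectors in the reduced Alexander module\<close>

lemma varsigma_eq_iff:
  assumes D: "wf_diagram D"
    and a: "a \<in> carrier (free_module (arcs D))" and b: "b \<in> carrier (free_module (arcs D))"
  shows "varsigma D a = varsigma D b \<longleftrightarrow> (\<lambda>s. a s - b s) \<in> rho_image D"
proof -
  let ?A = "free_module (arcs D)"
  interpret A: Module.module \<Lambda> ?A by (rule free_module_module)
  interpret N: submodule "rho_image D" \<Lambda> ?A by (rule rho_image_submodule[OF D])
  interpret N: abelian_subgroup "rho_image D" ?A
    by (rule abelian_subgroupI2[OF A.M.a_comm_group]) (rule N.subgroup_axioms)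
  have mem: "a \<in> varsigma D b \<longleftrightarrow> (\<lambda>s. a s - b s) \<in> rho_image D"
  proof
    assume "a \<in> varsigma D b"
    then obtain n where "n \<in> rho_image D" "a = (\<lambda>s. n s + b s)"
      by (auto simp: varsigma_def a_r_coset_def' free_module_def)
    then show "(\<lambda>s. a s - b s) \<in> rho_image D" by simp
  next
    assume "(\<lambda>s. a s - b s) \<in> rho_image D"
    then show "a \<in> varsigma D b"
      by (force simp: varsigma_def a_r_coset_def' free_module_def)
  qed
  show ?thesis
    using A.M.a_repr_independence[OF _ b N.a_subgroup, of a] N.a_rcos_self[OF a] mem
    by (auto simp: varsigma_def)
qed

section \<open>The Borromean rings\<close>

text \<open>The diagrams differ only in their writhes, which enter neither \<open>rho\<close> nor
  \<open>phi\<close>.\<close>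

lemma M_red_borromean: "M_red borromean_B' = M_red borromean_B"
  and varsigma_borromean: "varsigma borromean_B' = varsigma borromean_B"
  and meridians_borromean: "meridians borromean_B' = meridians borromean_B"
proof -
  have rho: "rho_image borromean_B' = rho_image borromean_B"
    by (simp add: rho_image_def rho_def borromean_B_def borromean_B'_def fun_eq_iff)
  show M: "M_red borromean_B' = M_red borromean_B"
    unfolding M_red_def rho by (simp add: borromean_B_def borromean_B'_def)
  show v: "varsigma borromean_B' = varsigma borromean_B"
    unfolding varsigma_def rho by (simp add: borromean_B_def borromean_B'_def)
  have "phi borromean_B' = phi borromean_B"
    by (simp add: phi_def phi_free_def phi_gen_def borromean_B_def borromean_B'_def fun_eq_iff)
  then show "meridians borromean_B' = meridians borromean_B"
    unfolding meridians_def M v by (simp add: borromean_B_def borromean_B'_def)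
qed

lemma comp_of_borromean [simp]: "comp_of borromean_B = borromean_comp"
  by (simp add: borromean_B_def)

lemma UNIV_borromean_arc: "UNIV = {Arc_u, Arc_v, Arc_w, Arc_x, Arc_y, Arc_z}"
  using borromean_arc.exhaust by blast

lemma arcs_borromean [simp]: "arcs borromean_B = UNIV"
  by (simp add: borromean_B_def UNIV_borromean_arc)

lemma rho_borromean:
  "rho borromean_B g s =
     g (Arc_y, Arc_u, Arc_v) * ((1 - tvar) * gen Arc_y s + tvar * gen Arc_u s - gen Arc_v s) +
     g (Arc_u, Arc_w, Arc_x) * ((1 - tvar) * gen Arc_u s + tvar * gen Arc_w s - gen Arc_x s) +
     g (Arc_w, Arc_y, Arc_z) * ((1 - tvar) * gen Arc_w s + tvar * gen Arc_y s - gen Arc_z s) +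
     g (Arc_z, Arc_u, Arc_v) * ((1 - tvar) * gen Arc_z s + tvar * gen Arc_u s - gen Arc_v s) +
     g (Arc_v, Arc_w, Arc_x) * ((1 - tvar) * gen Arc_v s + tvar * gen Arc_w s - gen Arc_x s) +
     g (Arc_x, Arc_y, Arc_z) * ((1 - tvar) * gen Arc_x s + tvar * gen Arc_y s - gen Arc_z s)"
  by (simp add: rho_def borromean_B_def add.assoc)

lemma longitude_borromean:
  "longitude borromean_B 1 = varsigma borromean_B (\<lambda>s. gen Arc_y s - gen Arc_z s)"
  "longitude borromean_B' 1 = varsigma borromean_B (\<lambda>s. gen Arc_z s - gen Arc_y s)"
proof -
  have "under_crossings borromean_B 1 = {(Arc_y, Arc_u, Arc_v), (Arc_z, Arc_u, Arc_v)}"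
    "under_crossings borromean_B' 1 = {(Arc_y, Arc_u, Arc_v), (Arc_z, Arc_u, Arc_v)}"
    by (auto simp: under_crossings_def borromean_B_def borromean_B'_def)
  then show
    "longitude borromean_B 1 = varsigma borromean_B (\<lambda>s. gen Arc_y s - gen Arc_z s)"
    "longitude borromean_B' 1 = varsigma borromean_B (\<lambda>s. gen Arc_z s - gen Arc_y s)"
    unfolding longitude_def varsigma_borromean
    by (simp_all add: under_coeff_borromean)
      (simp_all add: borromean_B_def borromean_B'_def)
qed

text \<open>The map of the overview kills four relations and sends those of
  \<open>(Arc_z, Arc_u, Arc_v)\<close> and \<open>(Arc_v, Arc_w, Arc_x)\<close> to -(1 - t)^2 and (1
  - t)^2. By the product rule every multiple of (1 - t)^2 has derivative 0 at 1.\<close>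

lemma rho_image_borromean_functional:
  assumes "h \<in> rho_image borromean_B"
  shows "deriv_at_1 ((1 - tvar) * h Arc_v + h Arc_y + tvar * h Arc_z) = 0"
proof -
  obtain g where g: "h = rho borromean_B g"
    using assms by (auto simp: rho_image_def)
  show ?thesis
    unfolding g rho_borromean
    by (simp add: gen_def deriv_at_1_add deriv_at_1_diff deriv_at_1_mult augmentation_add
        augmentation_diff augmentation_mult algebra_simps)
qed

text \<open>A kernel vector is a combination of v - u, x - w, z - y, (1 - t) (w - u) and (1 - t) (y
  - u), and 1 - t times each of these is a combination of relations.\<close>

lemma one_minus_tvar_mult_ker_phi:
  assumes "phi_free borromean_B h = (0, \<lambda>i. 0)"
  shows "(\<lambda>s. (1 - tvar) * h s) \<in> rho_image borromean_B"
proof -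
  have total: "h Arc_u + h Arc_v + h Arc_w + h Arc_x + h Arc_y + h Arc_z = 0"
    using assms by (simp add: phi_free_def phi_gen_def UNIV_borromean_arc add.assoc)
  \<comment> \<open>Coordinates 2 and 3 of \<open>phi_free\<close> are the augmentations of the
    total coefficients on the second and third components.\<close>
  have "augmentation (h Arc_w + h Arc_x) = 0"
    using fun_cong[of _ _ "2::nat", OF arg_cong[where f = snd, OF assms, simplified]]
    by (simp add: phi_free_def phi_gen_def UNIV_borromean_arc augmentation_add)
  then obtain A where A: "h Arc_w + h Arc_x = (1 - tvar) * A"
    using one_minus_tvar_dvd by (auto elim: dvdE)
  have "augmentation (h Arc_y + h Arc_z) = 0"
    using fun_cong[of _ _ "3::nat", OF arg_cong[where f = snd, OF assms, simplified]]
    by (simp add: phi_free_def phi_gen_def UNIV_borromean_arc augmentation_add)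
  then obtain B where B: "h Arc_y + h Arc_z = (1 - tvar) * B"
    using one_minus_tvar_dvd by (auto elim: dvdE)
  have w: "h Arc_w = (1 - tvar) * A - h Arc_x"
    using A by (simp add: algebra_simps)
  have y: "h Arc_y = (1 - tvar) * B - h Arc_z"
    using B by (simp add: algebra_simps)
  have u: "h Arc_u = - h Arc_v - (1 - tvar) * A - (1 - tvar) * B"
    using total unfolding w y by (simp add: algebra_simps eq_neg_iff_add_eq_0)
  \<comment> \<open>Numbering the relations \<open>r\<^sub>1, \<dots>, r\<^sub>6\<close> in the order of the cases below, these coefficients come
    from \<open>(1 - t) (z - y) = r\<^sub>4 - r\<^sub>1\<close>, \<open>(1 - t) (v - u) = r\<^sub>5 - r\<^sub>2\<close>, \<open>(1 - t) (x - w) = r\<^sub>6 - r\<^sub>3\<close>,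
    \<open>(1 - t)\<^sup>2 (y - u) = (1 - t) r\<^sub>1 - r\<^sub>2 + r\<^sub>5\<close> and \<open>(1 - t)\<^sup>2 (u - w) = (1 - t) r\<^sub>2 - r\<^sub>3 + r\<^sub>6\<close>.\<close>
  define g where "g = (\<lambda>c::borromean_arc \<times> borromean_arc \<times> borromean_arc.
    if c = (Arc_y, Arc_u, Arc_v) then (1 - tvar) * B - h Arc_z
    else if c = (Arc_u, Arc_w, Arc_x) then - h Arc_v - (1 - tvar) * A - B
    else if c = (Arc_w, Arc_y, Arc_z) then A - h Arc_x
    else if c = (Arc_z, Arc_u, Arc_v) then h Arc_z
    else if c = (Arc_v, Arc_w, Arc_x) then h Arc_v + B
    else if c = (Arc_x, Arc_y, Arc_z) then h Arc_x - A
    else 0)"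
  have "rho borromean_B g = (\<lambda>s. (1 - tvar) * h s)"
  proof
    show "rho borromean_B g s = (1 - tvar) * h s" for s
      by (cases s) (simp_all add: rho_borromean g_def gen_def u w y algebra_simps)
  qed
  moreover have "g \<in> carrier (free_module (crossings borromean_B))"
    by (auto simp: free_module_def g_def borromean_B_def)
  ultimately show ?thesis
    unfolding rho_image_def by (rule image_eqI[OF sym])
qed

lemma carrier_free_UNIV [simp]: "carrier (free_module UNIV) = UNIV"
  by (simp add: free_module_def)

text \<open>Two meridians of one component differ by an element of the kernel of \<open>phi\<close>,
  which 1 - t annihilates.\<close>

lemma smult_meridian_borromean:
  assumes K: "K \<in> meridians borromean_B (comp_of borromean_B a)"
  shows "(1 - tvar) \<odot>\<^bsub>M_red borromean_B\<^esub> K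
    = (1 - tvar) \<odot>\<^bsub>M_red borromean_B\<^esub> varsigma borromean_B (gen a)"
proof -
  let ?B = borromean_B
  obtain h where h: "K = varsigma ?B h"
    using K by (auto simp: meridians_def carrier_M_red)
  have "phi ?B K = phi ?B (varsigma ?B (gen a))"
    using K by (auto simp: meridians_def)
  then have "phi_free ?B h = phi_free ?B (gen a)"
    by (simp add: h phi_varsigma wf_borromean)
  then have "phi_free ?B (\<lambda>s. h s - gen a s) = (0, \<lambda>i. 0)"
    by (simp add: phi_free_def augmentation_diff left_diff_distrib sum_subtractf fun_eq_iff)
  then have "(\<lambda>s. (1 - tvar) * (h s - gen a s)) \<in> rho_image ?B"
    by (rule one_minus_tvar_mult_ker_phi)
  then have "varsigma ?B (\<lambda>s. (1 - tvar) * h s) = varsigma ?B (\<lambda>s. (1 - tvar) * gen a s)"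
    by (simp add: varsigma_eq_iff wf_borromean right_diff_distrib)
  moreover have "(1 - tvar) \<odot>\<^bsub>M_red ?B\<^esub> varsigma ?B k = varsigma ?B (\<lambda>s. (1 - tvar) * k s)" for k
    using varsigma_linear[OF wf_borromean(1)] by (auto simp: linear_maps_def free_module_def)
  ultimately show ?thesis
    by (simp add: h)
qed

lemma no_borromean_iso:
  assumes f: "f \<in> linear_maps \<Lambda> (M_red borromean_B) (M_red borromean_B')"
    and M2: "f ` meridians borromean_B 2 \<subseteq> meridians borromean_B' 2"
    and M3: "f ` meridians borromean_B 3 \<subseteq> meridians borromean_B' 3"
    and l: "f (longitude borromean_B 1) = longitude borromean_B' 1"
  shows False
proof -
  let ?B = borromean_B and ?M = "M_red borromean_B" and ?s = "varsigma borromean_B"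
  let ?l = "?s (\<lambda>s. gen Arc_y s - gen Arc_z s)"
  interpret M: Module.module \<Lambda> ?M
    by (rule M_red_module[OF wf_borromean(1)])
  have fadd: "f (x \<oplus>\<^bsub>?M\<^esub> y) = f x \<oplus>\<^bsub>?M\<^esub> f y"
    and fsmult: "f (r \<odot>\<^bsub>?M\<^esub> x) = r \<odot>\<^bsub>?M\<^esub> f x"
    and fclosed: "f x \<in> carrier ?M"
    if "x \<in> carrier ?M" "y \<in> carrier ?M" for r x y
    using f that by (auto simp: linear_maps_def M_red_borromean)
  have carr [simp]: "?s h \<in> carrier ?M" for h
    by (simp add: carrier_M_red)
  have sadd: "?s x \<oplus>\<^bsub>?M\<^esub> ?s y = ?s (\<lambda>s. x s + y s)"
    and ssmult: "r \<odot>\<^bsub>?M\<^esub> ?s x = ?s (\<lambda>s. r * x s)" for r x y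
    using varsigma_linear[OF wf_borromean(1)] by (auto simp: linear_maps_def free_module_def)
  have fixed: "f ((1 - tvar) \<odot>\<^bsub>?M\<^esub> ?s (gen a)) = (1 - tvar) \<odot>\<^bsub>?M\<^esub> ?s (gen a)"
    if "a = Arc_w \<or> a = Arc_y" for a
  proof -
    have "?s (gen a) \<in> meridians ?B (comp_of ?B a)"
      by (auto simp: meridians_def phi_varsigma_gen wf_borromean phi_gen_def)
    then have "f (?s (gen a)) \<in> meridians ?B (comp_of ?B a)"
      using that M2 M3 unfolding meridians_borromean by (auto simp: image_subset_iff)
    then show ?thesis
      by (simp add: fsmult[OF carr carr] smult_meridian_borromean)
  qed
  \<comment> \<open>This is the relation (1 - t) w + t y - z = 0 rearranged; it expresses the
    longitude y - z through the two elements that \<open>f\<close> fixes.\<close>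
  have eq: "(1 - tvar) \<odot>\<^bsub>?M\<^esub> ?s (gen Arc_y) = ?l \<oplus>\<^bsub>?M\<^esub> (1 - tvar) \<odot>\<^bsub>?M\<^esub> ?s (gen Arc_w)"
  proof -
    have "rho ?B (\<lambda>c. - gen (Arc_w, Arc_y, Arc_z) c) \<in> rho_image ?B"
      unfolding rho_image_def
      by (rule imageI) (auto simp: free_module_def gen_def borromean_B_def)
    moreover have "rho ?B (\<lambda>c. - gen (Arc_w, Arc_y, Arc_z) c)
      = (\<lambda>s. (1 - tvar) * gen Arc_y s - (gen Arc_y s - gen Arc_z s + (1 - tvar) * gen Arc_w s))"
      by (rule ext) (simp add: rho_borromean gen_def[of "(Arc_w, Arc_y, Arc_z)"] algebra_simps)
    ultimately show ?thesis
      by (simp add: sadd ssmult varsigma_eq_iff wf_borromean)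
  qed
  have "f ?l \<oplus>\<^bsub>?M\<^esub> (1 - tvar) \<odot>\<^bsub>?M\<^esub> ?s (gen Arc_w)
      = ?l \<oplus>\<^bsub>?M\<^esub> (1 - tvar) \<odot>\<^bsub>?M\<^esub> ?s (gen Arc_w)"
    using arg_cong[OF eq, of f] fixed[of Arc_w] fixed[of Arc_y] eq
    by (simp add: fadd)
  then have "f ?l = ?l"
    by (simp add: fclosed[OF carr carr])
  then have "?s (\<lambda>s. gen Arc_z s - gen Arc_y s) = ?l"
    using l unfolding longitude_borromean by simp
  then have "(\<lambda>s. gen Arc_z s - gen Arc_y s - (gen Arc_y s - gen Arc_z s)) \<in> rho_image ?B"
    by (subst (asm) varsigma_eq_iff) (simp_all add: wf_borromean)
  \<comment> \<open>The vector is 2 (z - y), which the map sends to 2 t - 2, with derivative 2 at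
    1.\<close>
  from rho_image_borromean_functional[OF this] show False
    by (simp add: gen_def deriv_at_1_add deriv_at_1_diff deriv_at_1_mult augmentation_add
        augmentation_diff)
qed

theorem mainTheorem4:
  shows "\<not> (\<exists>f \<in> module_isos \<Lambda> (M_red borromean_B) (M_red borromean_B').
            f ` meridians borromean_B 1 = meridians borromean_B' 1 \<and>
            f ` meridians borromean_B 2 = meridians borromean_B' 2 \<and>
            f ` meridians borromean_B 3 = meridians borromean_B' 3 \<and>
            f (longitude borromean_B 1) = longitude borromean_B' 1)
       \<and> enr_isos (M_enr borromean_B) (M_enr borromean_B') = {}"
proof -
  have *: False
    if "f \<in> module_isos \<Lambda> (M_red borromean_B) (M_red borromean_B')"
      "f ` meridians borromean_B 2 = meridians borromean_B' 2"
      "f ` meridians borromean_B 3 = meridians borromean_B' 3"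
      "f (longitude borromean_B 1) = longitude borromean_B' 1" for f
    using no_borromean_iso[of f] that by (auto simp: module_isos_def)
  \<comment> \<open>With explicit index lists, equality of the lists in \<open>M_enr\<close> splits
    into the conditions on single components.\<close>
  have upt: "[1..<Suc (num_comps borromean_B)] = [1, 2, 3]"
    "[1..<Suc (num_comps borromean_B')] = [1, 2, 3]"
    by (simp_all add: borromean_B_def borromean_B'_def upt_rec)
  have "enr_isos (M_enr borromean_B) (M_enr borromean_B') = {}"
  proof (rule equals0I)
    fix f assume "f \<in> enr_isos (M_enr borromean_B) (M_enr borromean_B')"
    then show False
      unfolding enr_isos_def M_enr_def upt by (intro *[of f]) simp_all
  qed
  then show ?thesis
    by (auto dest: *)
qed

end
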